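(* Let $F=f+h$ be as in the context. If $\{x_k\}_{k=0}^\infty$, $\{\phi_k(x)\}_{k=0}^\infty$ and $\{\alpha_k\}_{k=0}^\infty$ is an Underestimate Sequence (UES) of $F$, then for all $k\ge 0$ $$F(x_k)-\phi_k^* \le \lambda_k\,(F(x_0)-\phi_0^* ),$$ where $\lambda_0=1$ and $\lambda_{k+1}=(1-\alpha_k)\lambda_k$. Furthermore, since $\phi_k^*\le \phi_k(x^* )\le F^*$ for all $k\ge 0$, if $\lambda_k\to 0$, then $\{F(x_k)-F^*\}_{k=0}^\infty$ converges to $0$.
   Context: Setting: $F:=f+h$ on $\mathbb{R}^n$ (Euclidean norm), where $h:\mathbb{R}^n\to\mathbb{R}$ is convex (possibly nonsmooth) and $f:\mathbb{R}^n\to\mathbb{R}$ is continuously differentiable, $\mu$-strongly convex and $L$-smooth with $L\ge\mu>0$, i.e. for all $x,y\in\mathbb{R}^n$: $f(x)\ge f(y)+\langle\nabla f(y),x-y\rangle+\frac{\mu}{2}\|x-y\|^2$ and $f(x)\le f(y)+\langle\nabla f(y),x-y\rangle+\frac{L}{2}\|x-y\|^2$. $x^*$ denotes the minimizer of $F$ and $F^*:=F(x^* )$. Definition (UES). A series of sequences $\{x_k\}_{k=0}^\infty\subset\mathbb{R}^n$, $\{\phi_k(x)\}_{k=0}^\infty$ (real-valued functions on $\mathbb{R}^n$, each attaining its minimum) and $\{\alpha_k\}_{k=0}^\infty$ with $\alpha_k\in(0,1)$ for all $k\ge0$ is called an Underestimate Sequence (UES) of $F$ if for all $x\in\mathbb{R}^n$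 and all $k\ge0$: (i) $\phi_k(x)\le F(x)$; and (ii) $F(x_{k+1})-\phi_{k+1}^*\le(1-\alpha_k)(F(x_k)-\phi_k^* )$, where $\phi_k^*:=\min_x\phi_k(x)$. *)

theory Defs
  imports "HOL-Analysis.Analysis"
begin

definition attains_min :: "('a \<Rightarrow> real) \<Rightarrow> bool" where
  "attains_min g \<longleftrightarrow> (\<exists>z. is_arg_min g (\<lambda>_. True) z)"

text \<open>The minimum of \<open>g\<close>. It is meaningful only if \<open>g\<close> attains its minimum;
  otherwise \<open>LEAST\<close> gives an unspecified value.\<close>
definition min_val :: "('a \<Rightarrow> real) \<Rightarrow> real" where
  "min_val g = (LEAST v. v \<in> range g)"

text \<open>In the next two definitions \<open>gf\<close> plays the role of the gradient of \<open>f\<close>; that it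
  is the gradient is a separate hypothesis (\<open>GDERIV f x :> gf x\<close>).\<close>
definition strongly_convex ::
  "real \<Rightarrow> ('a::real_inner \<Rightarrow> real) \<Rightarrow> ('a \<Rightarrow> 'a) \<Rightarrow> bool" where
  "strongly_convex \<mu> f gf \<longleftrightarrow>
     (\<forall>x y. f x \<ge> f y + gf y \<bullet> (x - y) + \<mu> / 2 * (norm (x - y))\<^sup>2)"

definition L_smooth ::
  "real \<Rightarrow> ('a::real_inner \<Rightarrow> real) \<Rightarrow> ('a \<Rightarrow> 'a) \<Rightarrow> bool" where
  "L_smooth L f gf \<longleftrightarrow>
     (\<forall>x y. f x \<le> f y + gf y \<bullet> (x - y) + L / 2 * (norm (x - y))\<^sup>2)"

definition underestimate_seq ::
  "('a \<Rightarrow> real) \<Rightarrow> (nat \<Rightarrow> 'a) \<Rightarrow> (nat \<Rightarrow> 'a \<Rightarrow> real) \<Rightarrow> (nat \<Rightarrow> real) \<Rightarrow> bool" where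
  "underestimate_seq F x \<phi> \<alpha> \<longleftrightarrow>
     (\<forall>k. attains_min (\<phi> k)) \<and>
     (\<forall>k. 0 < \<alpha> k \<and> \<alpha> k < 1) \<and>
     (\<forall>k y. \<phi> k y \<le> F y) \<and>
     (\<forall>k. F (x (Suc k)) - min_val (\<phi> (Suc k)) \<le> (1 - \<alpha> k) * (F (x k) - min_val (\<phi> k)))"

primrec ues_lambda :: "(nat \<Rightarrow> real) \<Rightarrow> nat \<Rightarrow> real" where
  "ues_lambda \<alpha> 0 = 1"
| "ues_lambda \<alpha> (Suc k) = (1 - \<alpha> k) * ues_lambda \<alpha> k"

end

theory Submission
  imports Defs
begin

text \<open>The inequality for the gaps \<open>F (x k) - min_val (\<phi> k)\<close> is the contraction property of an
  underestimate sequence, iterated. The gap to the optimum, \<open>F (x k) - F xstar\<close>, lies between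
  \<open>0\<close> and \<open>F (x k) - min_val (\<phi> k)\<close>, and is squeezed to \<open>0\<close> when \<open>ues_lambda \<alpha>\<close> tends to \<open>0\<close>.

  Its nonnegativity needs \<open>xstar\<close> to be a genuine minimizer, and since \<open>ARG_MIN\<close> is a choice
  operator this requires that \<open>F\<close> attains its minimum. Usually one proves coercivity of \<open>F\<close> from an
  affine minorant of \<open>h\<close>. Here a shorter way is open: \<open>\<phi> 0\<close> lies below \<open>F\<close> and attains its
  minimum, so \<open>F\<close> is bounded below. Strong convexity at midpoints then bounds the sublevel sets of \<open>F\<close>
  (lemma \<open>midpoint_strongly_convex_attains_min\<close>), because the midpoint of two far apart points of
  a sublevel set would have a value below the given lower bound.\<close>

lemma min_val_le:
  assumes "attains_min g"
  shows "min_val g \<le> g y"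
proof -
  obtain z where z: "\<And>y. g z \<le> g y"
    using assms unfolding attains_min_def is_arg_min_linorder by blast
  have "min_val g = g z"
    unfolding min_val_def by (rule Least_equality) (use z in auto)
  with z show ?thesis by simp
qed

lemma arg_min_le:
  fixes F :: "'a \<Rightarrow> real"
  assumes "attains_min F"
  shows "F (ARG_MIN F y. True) \<le> F z"
proof -
  have "is_arg_min F (\<lambda>_. True) (ARG_MIN F y. True)"
    using assms unfolding attains_min_def arg_min_def by (rule someI_ex)
  then show ?thesis
    by (simp add: is_arg_min_linorder)
qed

text \<open>In the two strong convexity inequalities based at the midpoint of \<open>a\<close> and \<open>b\<close>, the
  displacements are opposite, so the gradient terms cancel in the average.\<close>

lemma strongly_convex_midpoint:
  assumes "strongly_convex \<mu> f gf"
  shows "f (midpoint a b) + \<mu> / 8 * (norm (a - b))\<^sup>2 \<le> (f a + f b) / 2"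
proof -
  define d where "d = (1/2) *\<^sub>R (a - b)"
  have da: "a - midpoint a b = d"
    by (simp add: d_def midpoint_def algebra_simps flip: scaleR_2)
  have db: "b - midpoint a b = - d"
    by (simp add: d_def midpoint_def algebra_simps flip: scaleR_2)
  have nd: "(norm d)\<^sup>2 = (norm (a - b))\<^sup>2 / 4"
    by (simp add: d_def power_divide)
  have "f a \<ge> f (midpoint a b) + gf (midpoint a b) \<bullet> d + \<mu> / 2 * (norm d)\<^sup>2"
    using assms da unfolding strongly_convex_def by metis
  moreover have "f b \<ge> f (midpoint a b) - gf (midpoint a b) \<bullet> d + \<mu> / 2 * (norm d)\<^sup>2"
    using assms db unfolding strongly_convex_def
    by (metis inner_minus_right norm_minus_cancel add_uminus_conv_diff)
  ultimately show ?thesis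
    unfolding nd by (simp add: field_simps)
qed

lemma convex_on_midpoint:
  assumes "convex_on UNIV h"
  shows "h (midpoint a b) \<le> (h a + h b) / 2"
  using convex_onD[OF assms, of "1/2" a b]
  by (simp add: midpoint_def scaleR_right_distrib add_divide_distrib)

text \<open>If \<open>c\<close> is a lower bound of \<open>F\<close>, then a point \<open>y\<close> with \<open>F y \<le> F 0\<close> satisfies
  \<open>c + m * (norm y)\<^sup>2 \<le> F 0\<close>, as one sees from the midpoint of \<open>y\<close> and \<open>0\<close>. The sublevel set through
  the origin is therefore compact.\<close>

lemma midpoint_strongly_convex_attains_min:
  fixes F :: "'a::euclidean_space \<Rightarrow> real"
  assumes "continuous_on UNIV F" and "0 < m"
    and mid: "\<And>a b. F (midpoint a b) + m * (norm (a - b))\<^sup>2 \<le> (F a + F b) / 2"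
    and lower: "\<And>y. c \<le> F y"
  shows "attains_min F"
proof -
  define S where "S = {y. F y \<le> F 0}"
  have "norm y \<le> sqrt ((F 0 - c) / m)" if "y \<in> S" for y
  proof -
    have "c + m * (norm y)\<^sup>2 \<le> F 0"
      using mid[of y 0] lower[of "midpoint y 0"] that by (simp add: S_def)
    then show ?thesis
      using \<open>0 < m\<close> by (intro real_le_rsqrt) (simp add: field_simps)
  qed
  then have "bounded S"
    by (auto simp: bounded_iff)
  moreover have "closed S"
    unfolding S_def using assms(1) by (intro closed_Collect_le) auto
  ultimately have "compact S"
    by (simp add: compact_eq_bounded_closed)
  moreover have "S \<noteq> {}"
    by (auto simp: S_def)
  moreover have "continuous_on S F"
    using assms(1) by (rule continuous_on_subset) simp
  ultimately obtain z where "z \<in> S" and z: "\<forall>y\<in>S. F z \<le> F y"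
    using continuous_attains_inf by blast
  then have "F z \<le> F y" for y
    by (cases "y \<in> S") (auto simp: S_def)
  then show ?thesis
    unfolding attains_min_def is_arg_min_linorder by blast
qed

lemma underestimate_seq_gap_le:
  assumes "underestimate_seq F x \<phi> \<alpha>"
  shows "F (x k) - min_val (\<phi> k) \<le> ues_lambda \<alpha> k * (F (x 0) - min_val (\<phi> 0))"
proof (induction k)
  case 0
  show ?case by simp
next
  case (Suc k)
  have "F (x (Suc k)) - min_val (\<phi> (Suc k)) \<le> (1 - \<alpha> k) * (F (x k) - min_val (\<phi> k))"
    using assms by (simp add: underestimate_seq_def)
  also have "\<dots> \<le> (1 - \<alpha> k) * (ues_lambda \<alpha> k * (F (x 0) - min_val (\<phi> 0)))"
    using assms Suc.IH by (intro mult_left_mono) (auto simp: underestimate_seq_def less_imp_le)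
  finally show ?case by (simp add: mult.assoc)
qed

theorem proposition1:
  fixes f h F :: "real ^ 'n \<Rightarrow> real" and gradf :: "real ^ 'n \<Rightarrow> real ^ 'n"
    and \<mu> L :: real
    and x :: "nat \<Rightarrow> real ^ 'n" and \<phi> :: "nat \<Rightarrow> real ^ 'n \<Rightarrow> real" and \<alpha> :: "nat \<Rightarrow> real"
    and xstar :: "real ^ 'n"
  assumes "0 < \<mu>" and "\<mu> \<le> L"
    and "convex_on UNIV h"
    and "\<And>y. GDERIV f y :> gradf y" and "continuous_on UNIV gradf"
    and "strongly_convex \<mu> f gradf" and "L_smooth L f gradf"
    and "\<And>y. F y = f y + h y"
    and "xstar = (ARG_MIN F y. True)"
    and "underestimate_seq F x \<phi> \<alpha>"
  shows "(\<forall>k. F (x k) - min_val (\<phi> k) \<le> ues_lambda \<alpha> k * (F (x 0) - min_val (\<phi> 0)))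
    \<and> (\<forall>k. min_val (\<phi> k) \<le> \<phi> k xstar \<and> \<phi> k xstar \<le> F xstar)
    \<and> (ues_lambda \<alpha> \<longlonglongrightarrow> 0 \<longrightarrow> (\<lambda>k. F (x k) - F xstar) \<longlonglongrightarrow> 0)"
proof -
  note ues = \<open>underestimate_seq F x \<phi> \<alpha>\<close>
  have min_phi: "min_val (\<phi> k) \<le> \<phi> k y" for k y
    using ues by (intro min_val_le) (simp add: underestimate_seq_def)
  have phi_F: "\<phi> k y \<le> F y" for k y
    using ues by (simp add: underestimate_seq_def)
  have F_eq: "F = (\<lambda>y. f y + h y)"
    using assms(8) by blast
  have "continuous_on UNIV f"
    using assms(4) unfolding gderiv_def
    by (meson has_derivative_continuous continuous_at_imp_continuous_on)
  moreover have "continuous_on UNIV h"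
    using assms(3) by (intro convex_on_continuous) auto
  ultimately have "continuous_on UNIV F"
    unfolding F_eq by (rule continuous_on_add)
  moreover have "F (midpoint a b) + \<mu> / 8 * (norm (a - b))\<^sup>2 \<le> (F a + F b) / 2" for a b
    using strongly_convex_midpoint[OF assms(6), of a b] convex_on_midpoint[OF assms(3), of a b]
    by (simp add: F_eq add_divide_distrib)
  moreover have "min_val (\<phi> 0) \<le> F y" for y
    using min_phi phi_F by (rule order_trans)
  ultimately have "attains_min F"
    using \<open>0 < \<mu>\<close> by (intro midpoint_strongly_convex_attains_min[where m = "\<mu> / 8"]) auto
  then have opt: "F xstar \<le> F y" for y
    unfolding assms(9) by (rule arg_min_le)
  have "(\<lambda>k. F (x k) - F xstar) \<longlonglongrightarrow> 0" if "ues_lambda \<alpha> \<longlonglongrightarrow> 0"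
  proof (rule tendsto_sandwich[where f = "\<lambda>_. 0"])
    show "(\<lambda>k. ues_lambda \<alpha> k * (F (x 0) - min_val (\<phi> 0))) \<longlonglongrightarrow> 0"
      using that by (rule tendsto_mult_left_zero)
    have "F (x k) - F xstar \<le> ues_lambda \<alpha> k * (F (x 0) - min_val (\<phi> 0))" for k
      using underestimate_seq_gap_le[OF ues, of k] min_phi[of k xstar] phi_F[of k xstar]
      by linarith
    then show "\<forall>\<^sub>F k in sequentially.
        F (x k) - F xstar \<le> ues_lambda \<alpha> k * (F (x 0) - min_val (\<phi> 0))"
      by simp
  qed (use opt in simp_all)
  then show ?thesis
    using underestimate_seq_gap_le[OF ues] min_phi phi_F by blast
qed

end
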